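(* Let $d$ be a positive integer and let $t_1,\ldots,t_n\in\mathbb{R}$ be distinct real numbers. Then the following three matroids on the ground set $\binom{[n]}{2}$ coincide: (1) the cofactor rigidity matroid $\mathcal{C}^{d-2}_{d-1}(\mathbf{q})$ of the planar points $\mathbf{q}_i=(t_i,t_i^2)$, $i=1,\dots,n$, on the standard parabola; (2) the bar-and-joint rigidity matroid $\mathcal{R}_d(\mathbf{p})$ of the points $\mathbf{p}_i=(t_i,t_i^2,\dots,t_i^d)\in\mathbb{R}^d$, $i=1,\dots,n$, on the moment curve; (3) the hyperconnectivity matroid $\mathcal{H}_d$ of the vectors $(1,t_i,\dots,t_i^{d-1})\in\mathbb{R}^d$, $i=1,\dots,n$; moreover, if no $t_i$ equals zero, this hyperconnectivity matroid equals the hyperconnectivity matroid $\mathcal{H}_d$ of the vectors $(t_i,t_i^2,\dots,t_i^d)$, $i=1,\dots,n$.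
   Context: For a list $\mathbf{p}=(\mathbf{p}_1,\dots,\mathbf{p}_n)$ of points in $\mathbb{R}^d$, all matrices below have rows indexed by pairs $\{i,j\}\in\binom{[n]}{2}$ (with $i<j$) and $nd$ columns grouped into $n$ consecutive blocks of size $d$; the row $\{i,j\}$ is zero outside blocks $i$ and $j$. The bar-and-joint rigidity matrix $R(\mathbf{p})$ has $\mathbf{p}_i-\mathbf{p}_j$ in block $i$ and $\mathbf{p}_j-\mathbf{p}_i$ in block $j$; its row matroid (linear matroid of the rows, ground set $\binom{[n]}{2}$) is $\mathcal{R}_d(\mathbf{p})$. The hyperconnectivity matrix $H(\mathbf{p})$ has $\mathbf{p}_j$ in block $i$ and $-\mathbf{p}_i$ in block $j$; its row matroid is the hyperconnectivity matroid $\mathcal{H}_d(\mathbf{p})$. For points $\mathbf{q}_1,\dots,\mathbf{q}_n\in\mathbb{R}^2$, let $c(x,y)=(x^{d-1},x^{d-2}y,\dots,xy^{d-2},y^{d-1})\in\mathbb{R}^d$; the cofactor rigidity matrix $C_d(\mathbf{q})$ has $c(\mathbf{q}_i-\mathbf{q}_j)$ in block $i$ and $-c(\mathbf{q}_i-\mathbf{q}_j)$ in block $j$; its row matroid is the cofactor rigidity matroid $\mathcal{C}^{d-2}_{d-1}(\mathbf{q})$. *)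

theory Defs
  imports "Jordan_Normal_Form.VS_Connect"
begin

definition pairs :: "nat \<Rightarrow> nat set set" where
  "pairs n = {e. e \<subseteq> {1..n} \<and> card e = 2}"

text \<open>A matroid is given by its ground set together with its family of independent sets.\<close>

type_synonym 'e matroid = "'e set \<times> 'e set set"

text \<open>
  A matrix with \<open>N\<close> columns whose rows are indexed by \<open>E\<close> is a map from \<open>E\<close> to row vectors of
  dimension \<open>N\<close>. A set of row indices is independent if the corresponding \<^emph>\<open>family\<close> of rows is
  linearly independent; since the library notion of linear dependence is about sets of vectors,
  repeated rows have to be excluded separately.
\<close>

definition row_matroid :: "nat \<Rightarrow> 'e set \<Rightarrow> ('e \<Rightarrow> real vec) \<Rightarrow> 'e matroid" where
  "row_matroid N E M =
     (E, {F. F \<subseteq> E \<and> inj_on M F \<and>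
             \<not> module.lin_dep class_ring (module_vec TYPE(real) N) (M ` F)})"

text \<open>
  The vector with \<open>n\<close> blocks of size \<open>d\<close> that has \<open>u\<close> in block \<open>i\<close>, \<open>v\<close> in block \<open>j\<close>, and zeros
  elsewhere. Blocks are numbered \<open>1, \<dots>, n\<close>, whereas vector coordinates start at \<open>0\<close>.
\<close>

definition block_row ::
  "nat \<Rightarrow> nat \<Rightarrow> nat \<Rightarrow> real vec \<Rightarrow> nat \<Rightarrow> real vec \<Rightarrow> real vec" where
  "block_row n d i u j v = vec (n * d) (\<lambda>c.
     if c div d + 1 = i then u $ (c mod d)
     else if c div d + 1 = j then v $ (c mod d)
     else 0)"

text \<open>In the row of \<open>{i, j}\<close> with \<open>i < j\<close>, we have \<open>i = Min {i, j}\<close> and \<open>j = Max {i, j}\<close>.\<close>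

definition rigidity_matrix :: "nat \<Rightarrow> nat \<Rightarrow> (nat \<Rightarrow> real vec) \<Rightarrow> nat set \<Rightarrow> real vec" where
  "rigidity_matrix n d p e =
     (let i = Min e; j = Max e in block_row n d i (p i - p j) j (p j - p i))"

definition hyperconnectivity_matrix ::
  "nat \<Rightarrow> nat \<Rightarrow> (nat \<Rightarrow> real vec) \<Rightarrow> nat set \<Rightarrow> real vec" where
  "hyperconnectivity_matrix n d p e =
     (let i = Min e; j = Max e in block_row n d i (p j) j (- p i))"

definition cofactor_vec :: "nat \<Rightarrow> real \<times> real \<Rightarrow> real vec" where
  "cofactor_vec d = (\<lambda>(x, y). vec d (\<lambda>k. x ^ (d - 1 - k) * y ^ k))"

definition cofactor_matrix :: "nat \<Rightarrow> nat \<Rightarrow> (nat \<Rightarrow> real \<times> real) \<Rightarrow> nat set \<Rightarrow> real vec" where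
  "cofactor_matrix n d q e =
     (let i = Min e; j = Max e;
          w = cofactor_vec d (fst (q i) - fst (q j), snd (q i) - snd (q j))
      in block_row n d i w j (- w))"

definition rigidity_matroid :: "nat \<Rightarrow> nat \<Rightarrow> (nat \<Rightarrow> real vec) \<Rightarrow> nat set matroid" where
  "rigidity_matroid n d p = row_matroid (n * d) (pairs n) (rigidity_matrix n d p)"

definition hyperconnectivity_matroid ::
  "nat \<Rightarrow> nat \<Rightarrow> (nat \<Rightarrow> real vec) \<Rightarrow> nat set matroid" where
  "hyperconnectivity_matroid n d p =
     row_matroid (n * d) (pairs n) (hyperconnectivity_matrix n d p)"

definition cofactor_matroid :: "nat \<Rightarrow> nat \<Rightarrow> (nat \<Rightarrow> real \<times> real) \<Rightarrow> nat set matroid" where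
  "cofactor_matroid n d q = row_matroid (n * d) (pairs n) (cofactor_matrix n d q)"

end

theory Submission
  imports Defs
begin

text \<open>
  Write \<open>s = t\<^sub>i + t\<^sub>j\<close>. The cofactor row of \<open>{i, j}\<close> is \<open>(t\<^sub>i - t\<^sub>j)\<^sup>d\<^sup>-\<^sup>1\<close> times
  \<open>(1, s, \<dots>, s\<^sup>d\<^sup>-\<^sup>1)\<close>, and the rigidity row is \<open>t\<^sub>i - t\<^sub>j\<close> times the vector of complete
  homogeneous polynomials \<open>\<Sum>l\<le>k. t\<^sub>i\<^sup>k\<^sup>-\<^sup>l t\<^sub>j\<^sup>l\<close>. Seen from block \<open>i\<close>, both vectors arise from
  \<open>(1, t\<^sub>j, \<dots>, t\<^sub>j\<^sup>d\<^sup>-\<^sup>1)\<close> by an invertible lower triangular matrix that depends on \<open>t\<^sub>i\<close> only, and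
  the signs of the two blocks match those of the hyperconnectivity matrix. So the three matrices
  differ by a nonzero scaling of the rows and an invertible column operation inside each block.
  For the vectors \<open>(t\<^sub>i, \<dots>, t\<^sub>i\<^sup>d)\<close> scale rows by \<open>t\<^sub>i t\<^sub>j\<close> and block \<open>i\<close> by \<open>1 / t\<^sub>i\<close>.
\<close>

section \<open>Linear independence of a family of rows, in coordinates\<close>

text \<open>Bridges the set-based \<open>lin_dep\<close> and relations with coefficients indexed by
  rows. A repeated row is itself such a relation, so the coefficient form absorbs
  injectivity.\<close>

lemma rows_independent_iff:
  fixes M :: "'e \<Rightarrow> real vec"
  assumes finF: "finite F" and M: "\<And>e. e \<in> F \<Longrightarrow> M e \<in> carrier_vec N"
  shows "inj_on M F \<and> \<not> module.lin_dep class_ring (module_vec TYPE(real) N) (M ` F) \<longleftrightarrow>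
    (\<forall>a. (\<forall>c<N. (\<Sum>e\<in>F. a e * M e $ c) = 0) \<longrightarrow> (\<forall>e\<in>F. a e = 0))"
    (is "_ \<longleftrightarrow> ?indep")
proof -
  interpret vec_space "TYPE(real)" N .
  have MF: "M ` F \<subseteq> carrier_vec N" using M by auto
  show ?thesis
  proof
    assume L: "inj_on M F \<and> \<not> lin_dep (M ` F)"
    then have inj: "inj_on M F" and indpt: "\<not> lin_dep (M ` F)" by auto
    show ?indep
    proof (intro allI impI ballI)
      fix a e
      assume a: "\<forall>c<N. (\<Sum>e\<in>F. a e * M e $ c) = 0" and e: "e \<in> F"
      \<comment> \<open>Injectivity lets the coefficients move from row indices to row
        vectors.\<close>
      define b where "b v = a (the_inv_into F M v)" for v
      have b: "b (M e) = a e" if "e \<in> F" for e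
        using that inj by (simp add: b_def the_inv_into_f_f)
      have "lincomb b (M ` F) $ c = 0" if "c < N" for c
      proof -
        have "lincomb b (M ` F) $ c = (\<Sum>v\<in>M ` F. b v * v $ c)"
          by (rule lincomb_index[OF that MF])
        also have "\<dots> = (\<Sum>e\<in>F. a e * M e $ c)"
          by (simp add: sum.reindex[OF inj] b)
        finally show ?thesis using a that by simp
      qed
      then have "lincomb b (M ` F) = 0\<^sub>v N"
        using lincomb_dim[OF _ MF, of b] finF by (intro eq_vecI) auto
      then have "lin_dep (M ` F)" if "b (M e) \<noteq> 0"
        unfolding lin_dep_def using finF e that
        by (intro exI[of _ "M ` F"] exI[of _ b] exI[of _ "M e"]) auto
      then show "a e = 0" using indpt b[OF e] by auto
    qed
  next
    assume R: ?indep
    have inj: "inj_on M F"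
    proof (rule inj_onI, rule ccontr)
      fix x y assume xy: "x \<in> F" "y \<in> F" "M x = M y" "x \<noteq> y"
      \<comment> \<open>Two equal rows satisfy the relation with coefficients 1 and -1.\<close>
      define a :: "'e \<Rightarrow> real" where
        "a e = (if e = x then 1 else 0) - (if e = y then 1 else 0)" for e
      have "(\<Sum>e\<in>F. a e * M e $ c) = 0" for c
      proof -
        have "(\<Sum>e\<in>F. a e * M e $ c) =
            (\<Sum>e\<in>F. if e = x then M e $ c else 0) - (\<Sum>e\<in>F. if e = y then M e $ c else 0)"
          unfolding sum_subtractf[symmetric] by (rule sum.cong) (auto simp: a_def)
        then show ?thesis using xy finF by simp
      qed
      then have "a x = 0" using R xy(1) by blast
      then show False using xy(4) by (simp add: a_def)
    qed
    moreover have "\<not> lin_dep (M ` F)"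
    proof
      assume "lin_dep (M ` F)"
      then obtain A b v where A: "finite A" "A \<subseteq> M ` F" "lincomb b A = 0\<^sub>v N" "v \<in> A" "b v \<noteq> 0"
        unfolding lin_dep_def by auto
      define a where "a e = (if M e \<in> A then b (M e) else 0)" for e
      have AN: "A \<subseteq> carrier_vec N" using A(2) MF by blast
      have "(\<Sum>e\<in>F. a e * M e $ c) = 0" if "c < N" for c
      proof -
        have "(\<Sum>e\<in>F. a e * M e $ c) = (\<Sum>v\<in>M ` F. if v \<in> A then b v * v $ c else 0)"
          by (subst sum.reindex[OF inj]) (auto simp: a_def intro!: sum.cong)
        also have "\<dots> = (\<Sum>v\<in>A. b v * v $ c)"
          using finF A(2) by (simp add: sum.inter_restrict[symmetric] Int_absorb1)
        also have "\<dots> = lincomb b A $ c"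
          by (rule lincomb_index[OF that AN, symmetric])
        finally show ?thesis using A(3) that by simp
      qed
      then have "a e = 0" if "e \<in> F" for e using R that by blast
      moreover obtain e where "e \<in> F" "v = M e" using A(2,4) by blast
      moreover have "a e \<noteq> 0" using \<open>v = M e\<close> A(4,5) by (simp add: a_def)
      ultimately show False by blast
    qed
    ultimately show "inj_on M F \<and> \<not> lin_dep (M ` F)" by blast
  qed
qed

section \<open>Row scalings and triangular column operations within blocks\<close>

lemma all_less_mult_iff:
  fixes n d :: nat
  shows "(\<forall>c<n * d. P c) \<longleftrightarrow> (\<forall>i<n. \<forall>k<d. P (i * d + k))"
proof (intro iffI allI impI)
  fix i k assume "\<forall>c<n * d. P c" "i < n" "k < d"
  moreover have "i * d + k < n * d"
  proof -
    have "i * d + k < Suc i * d" using \<open>k < d\<close> by simp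
    also have "\<dots> \<le> n * d" using \<open>i < n\<close> by (intro mult_le_mono1) simp
    finally show ?thesis .
  qed
  ultimately show "P (i * d + k)" by blast
next
  fix c assume *: "\<forall>i<n. \<forall>k<d. P (i * d + k)" and c: "c < n * d"
  have "d > 0" using c by (cases d) auto
  then have "P (c div d * d + c mod d)"
    using c by (intro *[rule_format]) (simp_all add: less_mult_imp_div_less)
  then show "P c" by simp
qed

text \<open>Forward substitution: once all earlier unknowns vanish, equation \<open>k\<close>
  reduces to \<open>T k k * x k = 0\<close>.\<close>

lemma triangular_kernel_trivial:
  fixes T :: "nat \<Rightarrow> nat \<Rightarrow> 'a::idom"
  assumes "\<And>k. k < d \<Longrightarrow> T k k \<noteq> 0"
    and "\<And>k. k < d \<Longrightarrow> (\<Sum>l\<le>k. T k l * x l) = 0"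
    and "k < d"
  shows "x k = 0"
  using \<open>k < d\<close>
proof (induction k rule: less_induct)
  case (less k)
  have "(\<Sum>l\<le>k. T k l * x l) = T k k * x k + (\<Sum>l<k. T k l * x l)"
    by (simp add: lessThan_Suc_atMost[symmetric])
  also have "(\<Sum>l<k. T k l * x l) = 0"
    using less by (intro sum.neutral) auto
  finally show ?case using assms(1,2) less.prems by simp
qed

text \<open>Row scalings only rescale the coefficients of a relation, and the column operation acts
  on each block of the combined row by an invertible triangular matrix. Hence \<open>a\<close> is a
  relation for \<open>M\<close> exactly when \<open>a e * s e\<close> is one for
  \<open>M'\<close>.\<close>

lemma row_matroid_eq_if_block_triangular:
  fixes M M' :: "'e \<Rightarrow> real vec" and T :: "nat \<Rightarrow> nat \<Rightarrow> nat \<Rightarrow> real"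
  assumes fin: "finite E"
    and M: "\<And>e. e \<in> E \<Longrightarrow> M e \<in> carrier_vec (n * d)"
    and M': "\<And>e. e \<in> E \<Longrightarrow> M' e \<in> carrier_vec (n * d)"
    and s: "\<And>e. e \<in> E \<Longrightarrow> s e \<noteq> 0"
    and T: "\<And>i k. i < n \<Longrightarrow> k < d \<Longrightarrow> T i k k \<noteq> 0"
    and eq: "\<And>e i k. e \<in> E \<Longrightarrow> i < n \<Longrightarrow> k < d \<Longrightarrow>
      M e $ (i * d + k) = s e * (\<Sum>l\<le>k. T i k l * M' e $ (i * d + l))"
  shows "row_matroid (n * d) E M = row_matroid (n * d) E M'"
proof -
  have dep: "(\<forall>c<n * d. (\<Sum>e\<in>F. a e * M e $ c) = 0) \<longleftrightarrow>
      (\<forall>c<n * d. (\<Sum>e\<in>F. (a e * s e) * M' e $ c) = 0)" if F: "F \<subseteq> E" for F a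
  proof -
    \<comment> \<open>Entry \<open>k\<close> in block \<open>i\<close> of the rescaled combination
      of the rows of \<open>M'\<close>.\<close>
    define x where "x i k = (\<Sum>e\<in>F. (a e * s e) * M' e $ (i * d + k))" for i k
    have Mx: "(\<Sum>e\<in>F. a e * M e $ (i * d + k)) = (\<Sum>l\<le>k. T i k l * x i l)"
      if "i < n" "k < d" for i k
    proof -
      have "a e * M e $ (i * d + k) = (\<Sum>l\<le>k. T i k l * ((a e * s e) * M' e $ (i * d + l)))"
        if "e \<in> F" for e
      proof -
        have "a e * M e $ (i * d + k) = (a e * s e) * (\<Sum>l\<le>k. T i k l * M' e $ (i * d + l))"
          using eq[of e i k] F that \<open>i < n\<close> \<open>k < d\<close> by (simp add: subset_iff)
        also have "\<dots> = (\<Sum>l\<le>k. T i k l * ((a e * s e) * M' e $ (i * d + l)))"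
          unfolding sum_distrib_left by (rule sum.cong) simp_all
        finally show ?thesis .
      qed
      then have "(\<Sum>e\<in>F. a e * M e $ (i * d + k)) =
          (\<Sum>e\<in>F. \<Sum>l\<le>k. T i k l * ((a e * s e) * M' e $ (i * d + l)))"
        by (rule sum.cong[OF refl])
      also have "\<dots> = (\<Sum>l\<le>k. T i k l * x i l)"
        unfolding x_def sum_distrib_left by (rule sum.swap)
      finally show ?thesis .
    qed
    have "(\<forall>k<d. (\<Sum>l\<le>k. T i k l * x i l) = 0) \<longleftrightarrow> (\<forall>k<d. x i k = 0)" if "i < n" for i
    proof
      assume *: "\<forall>k<d. (\<Sum>l\<le>k. T i k l * x i l) = 0"
      show "\<forall>k<d. x i k = 0"
        using triangular_kernel_trivial[where T = "T i" and x = "x i", OF T[OF that]] * by blast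
    qed simp
    then show ?thesis
      unfolding all_less_mult_iff x_def[symmetric] by (simp only: Mx cong: all_cong)
  qed
  have "inj_on M F \<and> \<not> module.lin_dep class_ring (module_vec TYPE(real) (n * d)) (M ` F) \<longleftrightarrow>
    inj_on M' F \<and> \<not> module.lin_dep class_ring (module_vec TYPE(real) (n * d)) (M' ` F)"
    if F: "F \<subseteq> E" for F
  proof -
    have finF: "finite F" using F fin finite_subset by blast
    have sF: "s e \<noteq> 0" if "e \<in> F" for e using s F that by blast
    have "(\<forall>a. (\<forall>c<n * d. (\<Sum>e\<in>F. a e * M e $ c) = 0) \<longrightarrow> (\<forall>e\<in>F. a e = 0)) \<longleftrightarrow>
      (\<forall>a. (\<forall>c<n * d. (\<Sum>e\<in>F. a e * M' e $ c) = 0) \<longrightarrow> (\<forall>e\<in>F. a e = 0))"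
      (is "?L \<longleftrightarrow> ?R")
    proof
      assume L: ?L
      show ?R
      proof (intro allI impI)
        fix a assume a: "\<forall>c<n * d. (\<Sum>e\<in>F. a e * M' e $ c) = 0"
        \<comment> \<open>A relation for \<open>M'\<close> is pulled back to \<open>M\<close> by
          dividing out the row scaling.\<close>
        have "(\<Sum>e\<in>F. (a e / s e * s e) * M' e $ c) = (\<Sum>e\<in>F. a e * M' e $ c)" for c
          using sF by (intro sum.cong) auto
        then have "\<forall>c<n * d. (\<Sum>e\<in>F. (a e / s e) * M e $ c) = 0"
          unfolding dep[OF F] using a by simp
        then have "\<forall>e\<in>F. a e / s e = 0" by (rule L[THEN spec, THEN mp])
        then show "\<forall>e\<in>F. a e = 0" using sF by simp
      qed
    next
      assume R: ?R
      show ?L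
      proof (intro allI impI)
        fix a assume "\<forall>c<n * d. (\<Sum>e\<in>F. a e * M e $ c) = 0"
        then have "\<forall>c<n * d. (\<Sum>e\<in>F. (a e * s e) * M' e $ c) = 0"
          unfolding dep[OF F] .
        then have "\<forall>e\<in>F. a e * s e = 0" by (rule R[THEN spec, THEN mp])
        then show "\<forall>e\<in>F. a e = 0" using sF by simp
      qed
    qed
    moreover have "M e \<in> carrier_vec (n * d)" "M' e \<in> carrier_vec (n * d)" if "e \<in> F" for e
      using M M' F that by blast+
    ultimately show ?thesis
      by (simp only: rows_independent_iff[OF finF])
  qed
  then show ?thesis unfolding row_matroid_def by auto
qed

section \<open>Rows supported on two blocks\<close>

lemma finite_pairs: "finite (pairs n)"
  by (rule finite_subset[of _ "Pow {1..n}"]) (auto simp: pairs_def)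

lemma pairsE:
  assumes "e \<in> pairs n"
  obtains "Min e \<in> {1..n}" "Max e \<in> {1..n}" "Min e < Max e"
proof -
  have e: "e \<subseteq> {1..n}" "card e = 2" using assms by (auto simp: pairs_def)
  then obtain x y where "e = {x, y}" "x \<noteq> y" by (meson card_2_iff)
  then show ?thesis using that e by (auto simp: min_def max_def)
qed

lemma block_row_carrier [simp]: "block_row n d i u j v \<in> carrier_vec (n * d)"
  by (simp add: block_row_def)

lemma block_row_index:
  assumes "b < n" "k < d"
  shows "block_row n d i u j v $ (b * d + k) =
    (if b + 1 = i then u $ k else if b + 1 = j then v $ k else 0)"
proof -
  \<comment> \<open>The bound comes from splitting the trivial statement that every
    \<open>c < n * d\<close> satisfies \<open>c < n * d\<close>.\<close>
  have "b * d + k < n * d" using all_less_mult_iff[of n d "\<lambda>c. c < n * d"] assms by blast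
  then show ?thesis using assms by (simp add: block_row_def)
qed

text \<open>Reduces the comparison of matroids to identities for the two nonzero blocks. The matrix
  \<open>T i\<close> belongs to the vertex \<open>i\<close>, so the same column operation serves
  every pair containing \<open>i\<close>.\<close>

lemma row_matroid_block_row_eq:
  fixes u v u' v' :: "nat set \<Rightarrow> real vec" and T :: "nat \<Rightarrow> nat \<Rightarrow> nat \<Rightarrow> real"
  assumes s: "\<And>e. e \<in> pairs n \<Longrightarrow> s e \<noteq> 0"
    and T: "\<And>i k. i \<in> {1..n} \<Longrightarrow> k < d \<Longrightarrow> T i k k \<noteq> 0"
    and u: "\<And>e k. e \<in> pairs n \<Longrightarrow> k < d \<Longrightarrow>
      u e $ k = s e * (\<Sum>l\<le>k. T (Min e) k l * u' e $ l)"
    and v: "\<And>e k. e \<in> pairs n \<Longrightarrow> k < d \<Longrightarrow>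
      v e $ k = s e * (\<Sum>l\<le>k. T (Max e) k l * v' e $ l)"
  shows "row_matroid (n * d) (pairs n) (\<lambda>e. block_row n d (Min e) (u e) (Max e) (v e)) =
    row_matroid (n * d) (pairs n) (\<lambda>e. block_row n d (Min e) (u' e) (Max e) (v' e))"
\<comment> \<open>Column blocks are counted from 0, vertices from 1.\<close>
proof (rule row_matroid_eq_if_block_triangular[where s = s and T = "\<lambda>b. T (b + 1)"])
  fix e b k assume e: "e \<in> pairs n" and b: "b < n" and k: "k < d"
  have "block_row n d (Min e) (u' e) (Max e) (v' e) $ (b * d + l) =
      (if b + 1 = Min e then u' e $ l else if b + 1 = Max e then v' e $ l else 0)"
    if "l \<le> k" for l
    using block_row_index[OF b, of l d] that k by simp
  then show "block_row n d (Min e) (u e) (Max e) (v e) $ (b * d + k) =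
    s e * (\<Sum>l\<le>k. T (b + 1) k l * block_row n d (Min e) (u' e) (Max e) (v' e) $ (b * d + l))"
    using u[OF e k] v[OF e k] by (simp add: block_row_index[OF b k])
qed (use s T finite_pairs in auto)

section \<open>Comparison with the hyperconnectivity matroid\<close>

text \<open>On the parabola \<open>y\<close>-differences factor as difference times sum, and the
  binomial theorem expands the powers of the sum. The diagonal entries of \<open>T\<close> are
  \<open>k choose k = 1\<close>.\<close>

lemma cofactor_matroid_parabola_eq_hyperconnectivity:
  assumes inj: "inj_on t {1..n}"
  shows "cofactor_matroid n d (\<lambda>i. (t i, t i ^ 2)) =
    hyperconnectivity_matroid n d (\<lambda>i. vec d (\<lambda>k. t i ^ k))"
  unfolding cofactor_matroid_def hyperconnectivity_matroid_def cofactor_matrix_def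
    hyperconnectivity_matrix_def Let_def
proof (rule row_matroid_block_row_eq[where s = "\<lambda>e. (t (Min e) - t (Max e)) ^ (d - 1)"
      and T = "\<lambda>i k l. of_nat (k choose l) * t i ^ (k - l)"])
  fix e assume e: "e \<in> pairs n"
  show "(t (Min e) - t (Max e)) ^ (d - 1) \<noteq> 0"
    using e by (rule pairsE) (use inj_onD[OF inj] in force)
  define x y where "x = t (Min e)" and "y = t (Max e)"
  fix k assume k: "k < d"
  have "(x - y) ^ (d - 1 - k) * (x\<^sup>2 - y\<^sup>2) ^ k =
      ((x - y) ^ (d - 1 - k) * (x - y) ^ k) * (y + x) ^ k"
    by (simp add: power2_eq_square square_diff_square_factored power_mult_distrib mult_ac add_ac)
  also have "(x - y) ^ (d - 1 - k) * (x - y) ^ k = (x - y) ^ (d - 1)"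
    using k by (simp add: power_add[symmetric])
  \<comment> \<open>With \<open>y\<close> as first summand, \<open>binomial_ring\<close> yields
    \<open>y ^ l * x ^ (k - l)\<close>, as the block of \<open>Min e\<close> requires.\<close>
  finally have w: "cofactor_vec d (x - y, x\<^sup>2 - y\<^sup>2) $ k = (x - y) ^ (d - 1) * (y + x) ^ k"
    using k by (simp add: cofactor_vec_def)
  have *: "l \<le> k \<Longrightarrow> l < d" for l using k by simp
  show "cofactor_vec d (fst (t (Min e), (t (Min e))\<^sup>2) - fst (t (Max e), (t (Max e))\<^sup>2),
      snd (t (Min e), (t (Min e))\<^sup>2) - snd (t (Max e), (t (Max e))\<^sup>2)) $ k =
    (t (Min e) - t (Max e)) ^ (d - 1) *
    (\<Sum>l\<le>k. of_nat (k choose l) * t (Min e) ^ (k - l) * vec d (\<lambda>k. t (Max e) ^ k) $ l)"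
    unfolding fst_conv snd_conv x_def[symmetric] y_def[symmetric] w binomial_ring
    by (simp add: * mult_ac)
  \<comment> \<open>In the block of \<open>Max e\<close> the roles of \<open>x\<close> and
    \<open>y\<close> are exchanged, hence the other order of summands.\<close>
  have w': "(- cofactor_vec d (x - y, x\<^sup>2 - y\<^sup>2)) $ k = - ((x - y) ^ (d - 1) * (x + y) ^ k)"
    using k w by (simp add: cofactor_vec_def add_ac)
  show "(- cofactor_vec d (fst (t (Min e), (t (Min e))\<^sup>2) - fst (t (Max e), (t (Max e))\<^sup>2),
      snd (t (Min e), (t (Min e))\<^sup>2) - snd (t (Max e), (t (Max e))\<^sup>2))) $ k =
    (t (Min e) - t (Max e)) ^ (d - 1) *
    (\<Sum>l\<le>k. of_nat (k choose l) * t (Max e) ^ (k - l) * (- vec d (\<lambda>k. t (Min e) ^ k)) $ l)"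
    unfolding fst_conv snd_conv x_def[symmetric] y_def[symmetric] w' binomial_ring
    by (simp add: * sum_negf mult_ac)
qed auto

text \<open>A difference of powers with exponent \<open>k + 1\<close> is the difference of the bases
  times a complete homogeneous polynomial of degree \<open>k\<close>. Read as a polynomial in the
  other endpoint, this gives a \<open>T\<close> with ones on the diagonal.\<close>

lemma rigidity_matroid_moment_curve_eq_hyperconnectivity:
  assumes inj: "inj_on t {1..n}"
  shows "rigidity_matroid n d (\<lambda>i. vec d (\<lambda>k. t i ^ (k + 1))) =
    hyperconnectivity_matroid n d (\<lambda>i. vec d (\<lambda>k. t i ^ k))"
  unfolding rigidity_matroid_def hyperconnectivity_matroid_def rigidity_matrix_def
    hyperconnectivity_matrix_def Let_def
proof (rule row_matroid_block_row_eq[where s = "\<lambda>e. t (Min e) - t (Max e)"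
      and T = "\<lambda>i k l. t i ^ (k - l)"])
  fix e assume e: "e \<in> pairs n"
  show "t (Min e) - t (Max e) \<noteq> 0"
    using e by (rule pairsE) (use inj_onD[OF inj] in force)
  fix k assume k: "k < d"
  have *: "l \<le> k \<Longrightarrow> l < d" for l using k by simp
  \<comment> \<open>The signs are placed to fit the block of \<open>Max e\<close>, which carries a
    negated vector; in the block of \<open>Min e\<close> they cancel.\<close>
  have diff: "x ^ (k + 1) - y ^ (k + 1) = (y - x) * (\<Sum>l\<le>k. x ^ (k - l) * - (y ^ l))" for x y :: real
    using diff_power_eq_sum[of y k x]
    by (simp add: lessThan_Suc_atMost sum_negf mult_ac)
  show "(vec d (\<lambda>k. t (Min e) ^ (k + 1)) - vec d (\<lambda>k. t (Max e) ^ (k + 1))) $ k =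
    (t (Min e) - t (Max e)) * (\<Sum>l\<le>k. t (Min e) ^ (k - l) * vec d (\<lambda>k. t (Max e) ^ k) $ l)"
    using diff[of "t (Min e)" "t (Max e)"] k
    by (simp add: * sum_negf) (simp add: algebra_simps)
  show "(vec d (\<lambda>k. t (Max e) ^ (k + 1)) - vec d (\<lambda>k. t (Min e) ^ (k + 1))) $ k =
    (t (Min e) - t (Max e)) * (\<Sum>l\<le>k. t (Max e) ^ (k - l) * (- vec d (\<lambda>k. t (Min e) ^ k)) $ l)"
    using diff[of "t (Max e)" "t (Min e)"] k by (simp add: *)
qed auto

text \<open>The row factor \<open>t (Min e) * t (Max e)\<close>, divided by the parameter of the
  block's own vertex, leaves the parameter of the other endpoint, which raises each exponent by
  one.\<close>

lemma hyperconnectivity_matroid_shift_exponent: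
  assumes nz: "\<And>i. i \<in> {1..n} \<Longrightarrow> t i \<noteq> 0"
  shows "hyperconnectivity_matroid n d (\<lambda>i. vec d (\<lambda>k. t i ^ (k + 1))) =
    hyperconnectivity_matroid n d (\<lambda>i. vec d (\<lambda>k. t i ^ k))"
  unfolding hyperconnectivity_matroid_def hyperconnectivity_matrix_def Let_def
proof (rule row_matroid_block_row_eq[where s = "\<lambda>e. t (Min e) * t (Max e)"
      and T = "\<lambda>i k l. if l = k then 1 / t i else 0"])
  fix e assume e: "e \<in> pairs n"
  have nz': "t (Min e) \<noteq> 0" "t (Max e) \<noteq> 0"
    using e by (rule pairsE; use nz in blast)+
  then show "t (Min e) * t (Max e) \<noteq> 0" by simp
  fix k assume k: "k < d"
  show "vec d (\<lambda>k. t (Max e) ^ (k + 1)) $ k = t (Min e) * t (Max e) *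
    (\<Sum>l\<le>k. (if l = k then 1 / t (Min e) else 0) * vec d (\<lambda>k. t (Max e) ^ k) $ l)"
    using k nz' by (simp add: if_distrib[of "\<lambda>x. x * _"] cong: if_cong)
  show "(- vec d (\<lambda>k. t (Min e) ^ (k + 1))) $ k = t (Min e) * t (Max e) *
    (\<Sum>l\<le>k. (if l = k then 1 / t (Max e) else 0) * (- vec d (\<lambda>k. t (Min e) ^ k)) $ l)"
    using k nz' by (simp add: if_distrib[of "\<lambda>x. x * _"] sum_negf cong: if_cong)
qed (use nz in auto)

theorem theorem1p1:
  fixes d n :: nat and t :: "nat \<Rightarrow> real"
  assumes "d > 0"
    and "inj_on t {1..n}"
  shows "cofactor_matroid n d (\<lambda>i. (t i, t i ^ 2))
           = rigidity_matroid n d (\<lambda>i. vec d (\<lambda>k. t i ^ (k + 1)))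
       \<and> rigidity_matroid n d (\<lambda>i. vec d (\<lambda>k. t i ^ (k + 1)))
           = hyperconnectivity_matroid n d (\<lambda>i. vec d (\<lambda>k. t i ^ k))
       \<and> ((\<forall>i\<in>{1..n}. t i \<noteq> 0) \<longrightarrow>
           hyperconnectivity_matroid n d (\<lambda>i. vec d (\<lambda>k. t i ^ k))
             = hyperconnectivity_matroid n d (\<lambda>i. vec d (\<lambda>k. t i ^ (k + 1))))"
proof (intro conjI impI)
  note rigidity = rigidity_matroid_moment_curve_eq_hyperconnectivity[OF assms(2)]
  show "cofactor_matroid n d (\<lambda>i. (t i, t i ^ 2)) =
      rigidity_matroid n d (\<lambda>i. vec d (\<lambda>k. t i ^ (k + 1)))"
    \<comment> \<open>The hyperconnectivity matroid is the common middle term.\<close>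
    unfolding rigidity by (rule cofactor_matroid_parabola_eq_hyperconnectivity[OF assms(2)])
  show "rigidity_matroid n d (\<lambda>i. vec d (\<lambda>k. t i ^ (k + 1))) =
      hyperconnectivity_matroid n d (\<lambda>i. vec d (\<lambda>k. t i ^ k))"
    by (rule rigidity)
  assume "\<forall>i\<in>{1..n}. t i \<noteq> 0"
  then show "hyperconnectivity_matroid n d (\<lambda>i. vec d (\<lambda>k. t i ^ k)) =
      hyperconnectivity_matroid n d (\<lambda>i. vec d (\<lambda>k. t i ^ (k + 1)))"
    by (intro hyperconnectivity_matroid_shift_exponent[symmetric]) blast
qed

end
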